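(* There exist two frequently hypercyclic weighted backward shifts $B_w,B_{w'}$ on $c_0(\mathbb Z_+)$ such that $B_w\oplus B_{w'}$ is not $\mathcal U$-frequently hypercyclic on $c_0(\mathbb Z_+)\oplus c_0(\mathbb Z_+)$.
   Context: For a bounded weight sequence $w=(w_n)_{n\ge1}$, the weighted backward shift is $B_we_0=0$, $B_we_n=w_ne_{n-1}$ ($n\ge1$), where $(e_k)$ is the canonical basis. $\mathcal N_T(x,V):=\{n\in\mathbb N:T^nx\in V\}$. $T$ is frequently hypercyclic (resp. $\mathcal U$-frequently hypercyclic) if there is $x$ such that $\mathcal N_T(x,V)$ has positive lower density (resp. positive upper density) for every non-empty open $V$. *)

theory Defs
  imports "HOL-Analysis.Analysis"
begin

definition c0 :: "(nat \<Rightarrow> complex) set" where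
  "c0 = {x. x \<longlonglongrightarrow> 0}"

definition c0_dist :: "(nat \<Rightarrow> complex) \<Rightarrow> (nat \<Rightarrow> complex) \<Rightarrow> real" where
  "c0_dist x y = (SUP n. cmod (x n - y n))"

definition c0_open :: "(nat \<Rightarrow> complex) set \<Rightarrow> bool" where
  "c0_open V \<longleftrightarrow> V \<subseteq> c0 \<and>
     (\<forall>x\<in>V. \<exists>e>0. \<forall>y\<in>c0. c0_dist x y < e \<longrightarrow> y \<in> V)"

definition c0_sum_open :: "((nat \<Rightarrow> complex) \<times> (nat \<Rightarrow> complex)) set \<Rightarrow> bool" where
  "c0_sum_open V \<longleftrightarrow> V \<subseteq> c0 \<times> c0 \<and>
     (\<forall>p\<in>V. \<exists>e>0. \<forall>q\<in>c0 \<times> c0.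
        max (c0_dist (fst p) (fst q)) (c0_dist (snd p) (snd q)) < e \<longrightarrow> q \<in> V)"

text \<open>Weighted backward shift: B_w e_0 = 0, B_w e_n = w_n e_(n-1), i.e.
  (B_w x)_k = w_(k+1) x_(k+1). The value w 0 is irrelevant.\<close>
definition bshift :: "(nat \<Rightarrow> complex) \<Rightarrow> (nat \<Rightarrow> complex) \<Rightarrow> (nat \<Rightarrow> complex)" where
  "bshift w x = (\<lambda>k. w (Suc k) * x (Suc k))"

definition bounded_weight :: "(nat \<Rightarrow> complex) \<Rightarrow> bool" where
  "bounded_weight w \<longleftrightarrow> bounded (w ` {1..})"

definition lower_density :: "nat set \<Rightarrow> ereal" where
  "lower_density A = liminf (\<lambda>N. ereal (real (card (A \<inter> {1..N})) / real N))"

definition upper_density :: "nat set \<Rightarrow> ereal" where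
  "upper_density A = limsup (\<lambda>N. ereal (real (card (A \<inter> {1..N})) / real N))"

definition return_set :: "('a \<Rightarrow> 'a) \<Rightarrow> 'a \<Rightarrow> 'a set \<Rightarrow> nat set" where
  "return_set T x V = {n. (T ^^ n) x \<in> V}"

definition freq_hypercyclic :: "'a set \<Rightarrow> ('a set \<Rightarrow> bool) \<Rightarrow> ('a \<Rightarrow> 'a) \<Rightarrow> bool" where
  "freq_hypercyclic X opn T \<longleftrightarrow>
     (\<exists>x\<in>X. \<forall>V. opn V \<and> V \<noteq> {} \<longrightarrow> lower_density (return_set T x V) > 0)"

definition U_freq_hypercyclic :: "'a set \<Rightarrow> ('a set \<Rightarrow> bool) \<Rightarrow> ('a \<Rightarrow> 'a) \<Rightarrow> bool" where
  "U_freq_hypercyclic X opn T \<longleftrightarrow>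
     (\<exists>x\<in>X. \<forall>V. opn V \<and> V \<noteq> {} \<longrightarrow> upper_density (return_set T x V) > 0)"

end

theory Submission
  imports Defs
begin

text \<open>
  Put W_k = w_1 ... w_k, so that (B^n x)_k = W_(n+k) x_(n+k) / W_k. If B^n x is close to e_0,
  then W_n |x_n| > 1/2, hence W_n tends to infinity along the return times n. A pair of shifts
  thus fails to be U-frequently hypercyclic as soon as the upper density of
  {n. W_n > C and W'_n > C} tends to 0 as C grows.

  Conversely, B_w is frequently hypercyclic if every target v^q, supported in [0, q], can be
  copied to positions n in a set E_q of positive lower density such that W is large on
  E_q + [0, q] and on (E_q - E_p) + [0, q]. Take E_q to be the multiples of 8^(q+2) lying in the
  windows [8^i, 2 * 8^i), where i ranges over an arithmetic progression J_q, the J_q being disjoint.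
  A difference of elements in distinct windows stays near the window of the larger one; a
  difference within one window forces p = q and is a multiple of 8^(q+2). So W only has to be
  large near windows and, to an extent growing with q, near multiples of 8^(q+2).
  Using windows with even i for W and with odd i for W', both W and W' exceed C only near
  multiples of 8^(q+2) with q at least of order C, a set of small density.
\<close>

section \<open>Windows, sites and weights\<close>

text \<open>The progression J_q: those i for which i - s has 2-adic valuation exactly
  \<open>Suc q\<close>. The exponent is \<open>Suc q\<close> and not \<open>q\<close> so that every
  i has the parity of \<open>s\<close>.\<close>

definition scales :: "nat \<Rightarrow> nat \<Rightarrow> nat set" where
  "scales s q = range (\<lambda>l. s + 2 ^ Suc q * (2 * l + 1))"

text \<open>A power of 8, so that the start 8^i of each window with i in \<open>scales s q\<close>
  is itself a multiple.\<close>

definition step :: "nat \<Rightarrow> nat" where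
  "step q = 8 ^ (q + 2)"

definition sites :: "nat \<Rightarrow> nat \<Rightarrow> nat set" where
  "sites s q = {n. step q dvd n \<and> (\<exists>i\<in>scales s q. 8 ^ i \<le> n \<and> n < 2 * 8 ^ i)}"

text \<open>\<open>demand s j r\<close> asks for W_j to be at least 2^r. The weights may not exceed 2, so
  \<open>height\<close>, the binary logarithm of W, is the least function meeting all demands that increases
  by at most 1 at each step.\<close>

definition demand :: "nat \<Rightarrow> nat \<Rightarrow> nat \<Rightarrow> bool" where
  "demand s j r \<longleftrightarrow>
     (\<exists>q. \<exists>i\<in>scales s q. 6 * 8 ^ (i - 1) \<le> j \<and> j \<le> 3 * 8 ^ i \<and> r = 3 * i) \<or>
     (\<exists>q d. 0 < d \<and> step q dvd d \<and> d \<le> j \<and> j \<le> d + q \<and> r = 3 * q)"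

definition height :: "nat \<Rightarrow> nat \<Rightarrow> nat" where
  "height s k = Sup (insert 0 {r + k - j | j r. demand s j r \<and> k \<le> j})"

text \<open>The products telescope and \<open>height s 0 = 0\<close>, so W_k = 2 ^
  \<open>height s k\<close>.\<close>

definition weight :: "nat \<Rightarrow> nat \<Rightarrow> complex" where
  "weight s k = of_real (2 ^ height s k / 2 ^ height s (k - 1))"

section \<open>Arithmetic of scales and steps\<close>

lemma Suc_le_power8: "Suc m \<le> 8 ^ m"
  by (induction m) auto

lemma less_power8: "m < (8::nat) ^ m"
  using Suc_le_power8[of m] by simp

lemma step_pos: "0 < step q"
  by (simp add: step_def)

lemma mult_le_step: "64 * q \<le> step q"
  using less_power8[of q] by (simp add: step_def power_add)

lemma less_step: "q < step q"
  using mult_le_step[of q] step_pos[of q] by linarith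

lemma scales_ge:
  assumes "i \<in> scales s q"
  shows "q + 2 \<le> i"
proof -
  obtain l where i: "i = s + 2 ^ Suc q * (2 * l + 1)"
    using assms by (auto simp: scales_def)
  have "q + 1 \<le> 2 ^ q"
    by (induction q) auto
  then have "q + 2 \<le> 2 ^ Suc q"
    by simp
  also have "\<dots> \<le> i"
    by (simp add: i)
  finally show ?thesis .
qed

lemma scales_disjoint:
  assumes "i \<in> scales s p" "i \<in> scales s q"
  shows "p = q"
proof -
  \<comment> \<open>Compares 2-adic valuations: if a < b, cancelling \<open>2 ^ Suc a\<close> would
    make the odd cofactor even.\<close>
  have *: "\<not> a < b" if "2 ^ Suc a * (2 * l + 1) = 2 ^ Suc b * (2 * m + (1::nat))" for a b l m :: nat
  proof
    assume "a < b"
    then obtain c where c: "b = Suc (a + c)"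
      using less_imp_Suc_add by blast
    have "2 ^ Suc a * (2 * l + 1) = 2 ^ Suc a * (2 * (2 ^ c * (2 * m + (1::nat))))"
      using that by (simp add: c power_add mult_ac)
    then have "2 * l + 1 = 2 * (2 ^ c * (2 * m + (1::nat)))"
      by (metis mult_left_cancel power_not_zero zero_neq_numeral)
    then show False
      by presburger
  qed
  obtain l where "i = s + 2 ^ Suc p * (2 * l + 1)"
    using assms(1) unfolding scales_def by blast
  moreover obtain m where "i = s + 2 ^ Suc q * (2 * m + 1)"
    using assms(2) unfolding scales_def by blast
  ultimately have "2 ^ Suc p * (2 * l + 1) = 2 ^ Suc q * (2 * m + (1::nat))"
    by simp
  from *[OF this] *[OF this[symmetric]] show ?thesis
    by simp
qed

lemma scales_parity: "i \<in> scales s q \<Longrightarrow> even i \<longleftrightarrow> even s"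
  by (auto simp: scales_def)

section \<open>The height function\<close>

text \<open>Makes the demands compatible with slope 1 and value 0 at 0: each term
  \<open>r + k - j\<close> is at most \<open>k\<close>, so the supremum defining
  \<open>height\<close> is taken over a bounded set.\<close>

lemma demand_le:
  assumes "demand s j r"
  shows "r \<le> j"
  using assms unfolding demand_def
proof (elim disjE exE bexE conjE)
  fix q i assume "i \<in> scales s q" and j: "6 * 8 ^ (i - 1) \<le> j" "r = 3 * i"
  then obtain m where m: "i = Suc m"
    using scales_ge by (metis Suc_le_D add_2_eq_Suc')
  show "r \<le> j"
    using j Suc_le_power8[of m] by (simp add: m)
next
  fix q d :: nat assume d: "0 < d" "step q dvd d" "d \<le> j" "r = 3 * q"
  then have "step q \<le> d"
    by (simp add: dvd_imp_le)
  then show "r \<le> j"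
    using d mult_le_step[of q] by linarith
qed

lemma height_upper: 
  assumes "\<And>j r. demand s j r \<Longrightarrow> k \<le> j \<Longrightarrow> r + k - j \<le> c"
  shows "height s k \<le> c"
  unfolding height_def using assms by (intro cSup_least) auto

lemma height_le: "height s k \<le> k"
  by (rule height_upper) (use demand_le in fastforce)

lemma demand_le_height:
  assumes "demand s j r" "k \<le> j"
  shows "r + k - j \<le> height s k"
  unfolding height_def
proof (rule cSup_upper)
  show "r + k - j \<in> insert 0 {r + k - j |j r. demand s j r \<and> k \<le> j}"
    using assms by blast
  show "bdd_above (insert 0 {r + k - j |j r. demand s j r \<and> k \<le> j})"
    by (rule bdd_aboveI[of _ k]) (use demand_le in fastforce)
qed

text \<open>Passing to \<open>Suc k\<close> raises each remaining term of the supremum by at most 1,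
  and the demands at \<open>k\<close> drop out. This bounds the weights by 2.\<close>

lemma height_Suc_le: "height s (Suc k) \<le> Suc (height s k)"
proof (rule height_upper)
  fix j r assume "demand s j r" "Suc k \<le> j"
  with demand_le_height[of s j r k] show "r + Suc k - j \<le> Suc (height s k)"
    by simp
qed

lemma less_height_witness:
  assumes "c < height s k"
  obtains j r where "demand s j r" "k \<le> j" "c < r + k - j"
  using height_upper[of s k c] assms by (meson not_le)

section \<open>Iterates of the shifts and the sup distance\<close>

lemma funpow_bshift_weight:
  "(bshift (weight s) ^^ n) x k =
     of_real (2 ^ height s (n + k) / 2 ^ height s k) * x (n + k)"
proof (induction n arbitrary: k)
  case (Suc n)
  have "(bshift (weight s) ^^ Suc n) x k =
      weight s (Suc k) * (of_real (2 ^ height s (n + Suc k) / 2 ^ height s (Suc k)) * x (n + Suc k))"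
    by (simp add: bshift_def[of "weight s"] Suc.IH)
  also have "\<dots> = of_real (2 ^ height s (Suc n + k) / 2 ^ height s k) * x (Suc n + k)"
    by (simp add: weight_def)
  finally show ?case .
qed simp

lemma norm_weight_le: "norm (weight s k) \<le> 2"
proof (cases k)
  case (Suc m)
  have "(2::real) ^ height s (Suc m) \<le> 2 ^ Suc (height s m)"
    by (intro power_increasing height_Suc_le) simp
  then show ?thesis
    by (simp add: weight_def Suc norm_divide norm_power divide_simps)
qed (simp add: weight_def)

lemma bounded_weight_weight: "bounded_weight (weight s)"
  unfolding bounded_weight_def bounded_iff using norm_weight_le by blast

lemma bshift_c0:
  assumes w: "\<And>k. norm (w k) \<le> c" and x: "x \<in> c0"
  shows "bshift w x \<in> c0"
proof -
  have "(\<lambda>k. x (Suc k)) \<longlonglongrightarrow> 0"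
    using x by (simp add: c0_def LIMSEQ_Suc)
  then have "(\<lambda>k. c * norm (x (Suc k))) \<longlonglongrightarrow> 0"
    by (intro tendsto_mult_right_zero tendsto_norm_zero)
  then have "(\<lambda>k. w (Suc k) * x (Suc k)) \<longlonglongrightarrow> 0"
    by (rule Lim_null_comparison[rotated])
       (auto simp: norm_mult intro!: always_eventually mult_right_mono w)
  then show ?thesis by (simp add: c0_def bshift_def)
qed

lemma funpow_bshift_c0:
  assumes "\<And>k. norm (w k) \<le> c" and "x \<in> c0"
  shows "(bshift w ^^ n) x \<in> c0"
  using assms by (induction n) (auto intro: bshift_c0)

lemma c0_dist_upper:
  assumes "x \<in> c0" "y \<in> c0"
  shows "norm (x n - y n) \<le> c0_dist x y"
proof -
  have "(\<lambda>n. x n - y n) \<longlonglongrightarrow> 0 - 0"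
    using assms unfolding c0_def by (intro tendsto_diff) auto
  then have "Bseq (\<lambda>n. x n - y n)"
    using convergent_imp_Bseq convergentI by blast
  then have "bdd_above (range (\<lambda>n. norm (x n - y n)))"
    by (metis BseqE bdd_above.I2)
  then show ?thesis
    unfolding c0_dist_def by (rule cSUP_upper2) auto
qed

lemma c0_dist_le:
  assumes "\<And>n. norm (x n - y n) \<le> e"
  shows "c0_dist x y \<le> e"
  unfolding c0_dist_def by (rule cSUP_least) (use assms in auto)

section \<open>Density estimates\<close>

lemma lower_density_pos:
  assumes "0 < c" and "\<And>N. N \<ge> M \<Longrightarrow> c * real N \<le> real (card (A \<inter> {1..N}))"
  shows "0 < lower_density A"
proof -
  have "ereal c \<le> lower_density A"
    unfolding lower_density_def
  proof (rule Liminf_bounded)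
    show "\<forall>\<^sub>F N in sequentially. ereal c \<le> ereal (real (card (A \<inter> {1..N})) / real N)"
      using eventually_ge_at_top[of "max 1 M"]
      by eventually_elim (use assms(2) in \<open>auto simp: field_simps\<close>)
  qed
  with \<open>0 < c\<close> show ?thesis
    using less_le_trans[of 0 "ereal c"] by simp
qed

lemma upper_density_le:
  assumes "\<And>N. N \<ge> M \<Longrightarrow> real (card (A \<inter> {1..N})) \<le> c * real N + a"
  shows "upper_density A \<le> ereal c"
proof -
  have "(\<lambda>N. c + a / real N) \<longlonglongrightarrow> c + 0"
    by (intro tendsto_add tendsto_const lim_const_over_n)
  then have lim: "(\<lambda>N. ereal (c + a / real N)) \<longlonglongrightarrow> ereal c"
    by simp
  have "upper_density A \<le> limsup (\<lambda>N. ereal (c + a / real N))"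
    unfolding upper_density_def
  proof (rule Limsup_mono)
    show "\<forall>\<^sub>F N in sequentially. ereal (real (card (A \<inter> {1..N})) / real N) \<le> ereal (c + a / real N)"
      using eventually_ge_at_top[of "max 1 M"]
      by eventually_elim (use assms in \<open>auto simp: field_simps\<close>)
  qed
  also have "\<dots> = ereal c"
    using lim by (simp add: lim_imp_Limsup)
  finally show ?thesis .
qed

lemma lower_density_mono:
  assumes "A \<subseteq> B"
  shows "lower_density A \<le> lower_density B"
  unfolding lower_density_def
  by (intro Liminf_mono always_eventually)
     (use assms in \<open>auto intro!: divide_right_mono card_mono\<close>)

text \<open>Take the last window [8^i, 2 * 8^i) that ends by N; it holds \<open>h\<close> = 8^i /
  \<open>step q\<close> sites. Consecutive scales differ by \<open>g\<close>, so N < 2 * 8^(i + g),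
  a fixed multiple of \<open>h\<close>; \<open>c\<close> is the inverse of that multiple.\<close>

lemma lower_density_sites: "0 < lower_density (sites s q)"
proof -
  define g where "g = (2::nat) ^ (q + 2)"
  define i0 where "i0 = s + (2::nat) ^ Suc q"
  define c where "c = 1 / (2 * 8 ^ g * real (step q))"
  show ?thesis
  proof (rule lower_density_pos)
    show "0 < c"
      using step_pos[of q] by (simp add: c_def)
    fix N :: nat assume N: "2 * 8 ^ i0 \<le> N"
    define I where "I = {i \<in> scales s q. 2 * 8 ^ i \<le> N}"
    have "finite I"
    proof (rule finite_subset)
      show "I \<subseteq> {..N}"
      proof
        fix i assume "i \<in> I"
        then show "i \<in> {..N}"
          using less_power8[of i] by (simp add: I_def)
      qed
    qed simp
    have "i0 \<in> scales s q"
      unfolding scales_def i0_def by (rule range_eqI[of _ _ 0]) simp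
    with N have "I \<noteq> {}"
      by (auto simp: I_def)
    define i where "i = Max I"
    have "i \<in> I"
      using \<open>finite I\<close> \<open>I \<noteq> {}\<close> by (simp add: i_def)
    then obtain l where i: "i = s + 2 ^ Suc q * (2 * l + 1)" and iN: "2 * 8 ^ i \<le> N"
      and isc: "i \<in> scales s q"
      by (auto simp: I_def scales_def)
    have "i + g \<in> scales s q"
      unfolding scales_def by (rule range_eqI[of _ _ "Suc l"]) (simp add: i g_def algebra_simps)
    moreover have "i + g \<notin> I"
      using Max_ge[OF \<open>finite I\<close>, of "i + g"] by (auto simp: i_def g_def)
    ultimately have Nlt: "N < 2 * 8 ^ (i + g)"
      by (simp add: I_def)
    define h where "h = (8::nat) ^ (i - (q + 2))"
    have h: "(8::nat) ^ i = step q * h"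
      unfolding step_def h_def using scales_ge[OF isc]
      by (metis le_add_diff_inverse power_add)
    have "(\<lambda>j. 8 ^ i + step q * j) ` {..<h} \<subseteq> sites s q \<inter> {1..N}"
    proof safe
      fix j assume "j < h"
      then have "step q * j < 8 ^ i"
        by (simp add: h step_pos)
      moreover have "step q dvd 8 ^ i"
        by (simp add: h)
      ultimately show "8 ^ i + step q * j \<in> sites s q" "8 ^ i + step q * j \<in> {1..N}"
        using iN by (auto simp: sites_def Suc_le_eq intro!: bexI[OF _ isc])
    qed
    then have "card ((\<lambda>j. 8 ^ i + step q * j) ` {..<h}) \<le> card (sites s q \<inter> {1..N})"
      by (intro card_mono) auto
    moreover have "inj_on (\<lambda>j. 8 ^ i + step q * j) {..<h}"
      using step_pos[of q] by (auto simp: inj_on_def)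
    ultimately have le: "h \<le> card (sites s q \<inter> {1..N})"
      by (simp add: card_image)
    have "N < 2 * 8 ^ g * step q * h"
      using Nlt by (simp add: power_add h mult_ac)
    then have "real N \<le> real (2 * 8 ^ g * step q * h)"
      by linarith
    then have "c * real N \<le> real h"
      using step_pos[of q] by (simp add: c_def divide_simps mult_ac)
    with le show "c * real N \<le> real (card (sites s q \<inter> {1..N}))"
      by linarith
  qed
qed

section \<open>Where both heights are large\<close>

text \<open>Contains every point that the demands near multiples d of \<open>step q\<close> can lift
  above 0: the plateau [d, d + q] and, by the slope 1, a ramp of length \<open>3 * q\<close> before
  it.\<close>

definition collars :: "nat \<Rightarrow> nat set" where
  "collars q = {k. \<exists>d>0. step q dvd d \<and> d \<le> k + 3 * q \<and> k \<le> d + q}"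

text \<open>Outside these collars a height above \<open>3 * Q\<close> comes from a window demand,
  which puts k into [4 * 8^(i-1), 4 * 8^i). These intervals are disjoint for distinct i, whereas the
  two weights ask for an even and an odd i.\<close>

lemma heights_collars:
  assumes "3 * Q < height 0 k" "3 * Q < height 1 k"
  shows "\<exists>q\<ge>Q. k \<in> collars q"
proof (rule ccontr)
  assume contra: "\<not> ?thesis"
  have *: "\<exists>i. (even i \<longleftrightarrow> even s) \<and> 4 * 8 ^ (i - 1) \<le> k \<and> k < 4 * 8 ^ i \<and> 0 < i"
    if "3 * Q < height s k" for s
  proof -
    from that obtain j r where j: "demand s j r" "k \<le> j" "3 * Q < r + k - j"
      by (rule less_height_witness)
    show ?thesis
      using j(1) unfolding demand_def
    proof (elim disjE exE bexE conjE)
      fix q i assume i: "i \<in> scales s q" "6 * 8 ^ (i - 1) \<le> j" "j \<le> 3 * 8 ^ i" "r = 3 * i"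
      obtain m where m: "i = Suc (Suc m)"
        using scales_ge[OF i(1)] by (metis Suc_le_D add_2_eq_Suc' Suc_le_mono)
      \<comment> \<open>The ramp before the plateau is shorter than \<open>3 * i\<close>, so it
        starts no earlier than (6 - 2) * 8^(i-1).\<close>
      have "3 * i \<le> 2 * 8 ^ (i - 1)"
        using Suc_le_power8[of m] by (simp add: m)
      then have "4 * 8 ^ (i - 1) \<le> k"
        using i j by linarith
      moreover have "3 * 8 ^ i < 4 * (8::nat) ^ i"
        by simp
      then have "k < 4 * 8 ^ i"
        using i j(2) by linarith
      ultimately show ?thesis
        using scales_parity[OF i(1)] m by blast
    next
      fix q d assume d: "0 < d" "step q dvd d" "d \<le> j" "j \<le> d + q" "r = 3 * q"
      then have "k \<in> collars q" "q \<ge> Q"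
        using j by (auto simp: collars_def)
      with contra show ?thesis by blast
    qed
  qed
  obtain a b where a: "even a" "4 * 8 ^ (a - 1) \<le> k" "k < 4 * 8 ^ a" "0 < a"
    and b: "odd b" "4 * 8 ^ (b - 1) \<le> k" "k < 4 * 8 ^ b" "0 < b"
    using *[OF assms(1)] *[OF assms(2)] by auto
  have "(8::nat) ^ (a - 1) < 8 ^ b" "(8::nat) ^ (b - 1) < 8 ^ a"
    using a b by linarith+
  then have "a - 1 < b" "b - 1 < a"
    by simp_all
  with a b have "a = b" by linarith
  with a b show False by simp
qed

text \<open>Each multiple of \<open>step q\<close> contributes at most \<open>4 * q + 1\<close>
  points. The bound holds for every N, not just in the limit, and is geometric in q, so it can be
  summed over all large q.\<close>

lemma card_collars_le: "real (card (collars q \<inter> {1..N})) \<le> real N * (1/2) ^ (q + 1)"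
proof -
  define M where "M = (N + 3 * q) div step q"
  have "collars q \<inter> {1..N} \<subseteq> (\<Union>l\<in>{1..M}. {step q * l - 3 * q..step q * l + q})"
  proof
    fix k assume "k \<in> collars q \<inter> {1..N}"
    then obtain l where k: "k \<le> N" "0 < step q * l" "step q * l \<le> k + 3 * q" "k \<le> step q * l + q"
      by (auto simp: collars_def elim!: dvdE)
    have "l \<le> M"
      unfolding M_def using k step_pos[of q] by (simp add: less_eq_div_iff_mult_less_eq mult.commute)
    moreover have "1 \<le> l"
      using k by (cases l) auto
    ultimately show "k \<in> (\<Union>l\<in>{1..M}. {step q * l - 3 * q..step q * l + q})"
      using k by (intro UN_I[of l]) auto
  qed
  then have "card (collars q \<inter> {1..N}) \<le> card (\<Union>l\<in>{1..M}. {step q * l - 3 * q..step q * l + q})"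
    by (intro card_mono) auto
  also have "\<dots> \<le> (\<Sum>l\<in>{1..M}. card {step q * l - 3 * q..step q * l + q})"
    by (rule card_UN_le) simp
  also have "\<dots> \<le> (\<Sum>l\<in>{1..M}. 4 * q + 1)"
    by (intro sum_mono) auto
  finally have card: "card (collars q \<inter> {1..N}) \<le> M * (4 * q + 1)"
    by simp
  \<comment> \<open>If any multiple occurs, then \<open>step q <= N + 3 * q\<close>; as
    \<open>64 * q <= step q\<close>, the boundary term \<open>3 * q\<close> is at most N.\<close>
  have "M * step q \<le> 2 * N"
  proof (cases "M = 0")
    case False
    have "M * step q \<le> N + 3 * q"
      by (simp add: M_def)
    moreover have "step q \<le> M * step q"
      using False by simp
    ultimately show ?thesis
      using mult_le_step[of q] by linarith
  qed simp
  moreover have "(4 * q + 1) * 2 ^ (q + 2) \<le> step q"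
  proof -
    have "q + 1 \<le> 2 ^ q"
      by (induction q) auto
    then have "(4 * q + 1) * 2 ^ (q + 2) \<le> (4 * 2 ^ q) * 2 ^ (q + 2)"
      by (intro mult_right_mono) linarith+
    also have "\<dots> = 16 * (4 ^ q)"
      by (simp add: power_add mult_ac flip: power_mult_distrib)
    also have "\<dots> \<le> 64 * 8 ^ q"
      by (intro mult_mono power_mono) auto
    finally show ?thesis
      by (simp add: step_def power_add)
  qed
  ultimately have "M * ((4 * q + 1) * 2 ^ (q + 2)) \<le> 2 * N"
    by (meson le_trans mult_le_mono2)
  then have "(M * (4 * q + 1)) * 2 ^ (q + 1) \<le> N"
    by (simp add: algebra_simps)
  with card have "card (collars q \<inter> {1..N}) * 2 ^ (q + 1) \<le> N"
    by (meson le_trans mult_le_mono1)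
  then have "real (card (collars q \<inter> {1..N}) * 2 ^ (q + 1)) \<le> real N"
    by linarith
  then show ?thesis
    by (simp add: power_one_over field_simps)
qed

lemma sum_half_powers_le: "(\<Sum>q=Q..N. (1/2::real) ^ (q + 1)) \<le> (1/2) ^ Q"
proof (cases "Q \<le> N")
  case True
  then have "(\<Sum>q=Q..N. (1/2::real) ^ (q + 1)) = (1/2) ^ Q - (1/2) ^ (N + 1)"
    by (induction N rule: dec_induct) auto
  then show ?thesis by simp
qed simp

lemma card_UN_collars_le:
  "real (card ((\<Union>q\<in>{Q..}. collars q) \<inter> {1..N})) \<le> (1/2) ^ Q * real N"
proof -
  \<comment> \<open>The union becomes finite: a collar meeting [1, N] has
    \<open>step q <= N + 3 * q\<close>, hence q <= N.\<close>
  have "(\<Union>q\<in>{Q..}. collars q) \<inter> {1..N} \<subseteq> (\<Union>q\<in>{Q..N}. collars q \<inter> {1..N})"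
  proof
    fix k assume "k \<in> (\<Union>q\<in>{Q..}. collars q) \<inter> {1..N}"
    then obtain q d where q: "Q \<le> q" "k \<in> collars q" "k \<in> {1..N}"
      and d: "0 < d" "step q dvd d" "d \<le> k + 3 * q"
      by (auto simp: collars_def)
    have "step q \<le> d"
      using d by (simp add: dvd_imp_le)
    with d q have "q \<le> N"
      using mult_le_step[of q] by auto
    with q show "k \<in> (\<Union>q\<in>{Q..N}. collars q \<inter> {1..N})"
      by auto
  qed
  then have "card ((\<Union>q\<in>{Q..}. collars q) \<inter> {1..N}) \<le> card (\<Union>q\<in>{Q..N}. collars q \<inter> {1..N})"
    by (intro card_mono) auto
  also have "\<dots> \<le> (\<Sum>q=Q..N. card (collars q \<inter> {1..N}))"
    by (rule card_UN_le) simp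
  finally have "real (card ((\<Union>q\<in>{Q..}. collars q) \<inter> {1..N})) \<le>
      (\<Sum>q=Q..N. real (card (collars q \<inter> {1..N})))"
    using of_nat_mono by fastforce
  also have "\<dots> \<le> (\<Sum>q=Q..N. real N * (1/2) ^ (q + 1))"
    by (intro sum_mono card_collars_le)
  also have "\<dots> = real N * (\<Sum>q=Q..N. (1/2) ^ (q + 1))"
    by (simp add: sum_distrib_left)
  also have "\<dots> \<le> real N * (1/2) ^ Q"
    by (intro mult_left_mono sum_half_powers_le) simp
  finally show ?thesis
    by (simp add: mult.commute)
qed

section \<open>Separation of the sites\<close>

lemma sites_diff:
  assumes m: "m \<in> sites s q" and n: "n \<in> sites s p" and "n < m"
  obtains (same) "p = q" "0 < m - n" "step q dvd m - n"
    | (apart) i where "i \<in> scales s q" "p < i" "6 * 8 ^ (i - 1) \<le> m - n" "m < 2 * 8 ^ i"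
proof -
  obtain i where i: "i \<in> scales s q" "8 ^ i \<le> m" "m < 2 * 8 ^ i"
    using m by (auto simp: sites_def)
  obtain j where j: "j \<in> scales s p" "8 ^ j \<le> n" "n < 2 * 8 ^ j"
    using n by (auto simp: sites_def)
  consider "i = j" | "i < j" | "j < i"
    by linarith
  then show thesis
  proof cases
    case 1
    then have "p = q"
      using i j scales_disjoint by blast
    with m n \<open>n < m\<close> show thesis
      by (intro same) (auto simp: sites_def)
  next
    case 2
    then have "(8::nat) ^ Suc i \<le> 8 ^ j"
      by (intro power_increasing) auto
    with i j \<open>n < m\<close> show thesis
      by simp
  next
    case 3
    then obtain l where l: "i = Suc l" "j \<le> l"
      by (metis Suc_le_D Suc_le_eq Suc_le_mono)
    then have "(8::nat) ^ j \<le> 8 ^ l"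
      by (intro power_increasing) auto
    \<comment> \<open>The gap exceeds 8^i - 2 * 8^(i-1) = 6 * 8^(i-1), whence the lower end of the
      range in \<open>demand\<close>.\<close>
    then have "6 * 8 ^ (i - 1) \<le> m - n"
      using i(2) j(3) unfolding l diff_Suc_1 power_Suc by linarith
    with i 3 scales_ge[OF j(1)] show thesis
      by (intro apart[of i]) auto
  qed
qed

text \<open>The copy placed at n occupies [n, n + p] and ends before the next site.\<close>

lemma sites_gap:
  assumes "m \<in> sites s q" "n \<in> sites s p" "n < m"
  shows "n + p < m"
  using assms
proof (cases rule: sites_diff)
  case same
  then have "step q \<le> m - n"
    by (simp add: dvd_imp_le)
  with same less_step[of q] show ?thesis
    by simp
next
  case (apart i)
  then have "i \<le> 8 ^ (i - 1)"
    using Suc_le_power8[of "i - 1"] by simp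
  with apart show ?thesis
    by linarith
qed

text \<open>Blocks at distinct sites are disjoint, and the window of a site determines its index.
  Hence the choice made in \<open>pattern\<close> is forced.\<close>

lemma sites_unique:
  assumes "m \<in> sites s q" "n \<in> sites s p" "t \<le> q" "u \<le> p" "m + t = n + u"
  shows "m = n \<and> q = p \<and> t = u"
proof -
  have "m = n"
    using sites_gap[of m s q n p] sites_gap[of n s p m q] assms by linarith
  moreover have "q = p"
  proof -
    obtain i where i: "i \<in> scales s q" "8 ^ i \<le> m" "m < 2 * 8 ^ i"
      using assms(1) by (auto simp: sites_def)
    obtain j where j: "j \<in> scales s p" "8 ^ j \<le> n" "n < 2 * 8 ^ j"
      using assms(2) by (auto simp: sites_def)
    have False if "a < b" "8 ^ b \<le> k" "k < 2 * 8 ^ a" for a b k :: nat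
    proof -
      have "(8::nat) ^ Suc a \<le> 8 ^ b"
        using that by (intro power_increasing) auto
      with that show False by simp
    qed
    then have "i = j"
      using i j \<open>m = n\<close> by (meson linorder_neqE_nat)
    with i j show "q = p"
      using scales_disjoint by blast
  qed
  ultimately show ?thesis
    using assms by simp
qed

lemma scales_bound: "i \<in> scales s q \<Longrightarrow> m < 2 * 8 ^ i \<Longrightarrow> t \<le> q \<Longrightarrow> m + t \<le> 3 * 8 ^ i"
  using scales_ge[of i s q] less_power8[of i] by linarith

text \<open>The part \<open>2 * q\<close> will absorb the size 2^(2q) of the copy at m, and
  \<open>p\<close> leaves an error 2^(-p). Within one window p = q and the demand is
  \<open>3 * q\<close>; otherwise it is \<open>3 * i\<close> with i above both p and q.\<close>

lemma height_sites_diff: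
  assumes "m \<in> sites s q" "n \<in> sites s p" "n < m" "t \<le> q"
  shows "2 * q + p \<le> height s (m - n + t)"
  using assms(1-3)
proof (cases rule: sites_diff)
  case same
  then have "demand s (m - n + t) (3 * q)"
    using assms(4) unfolding demand_def by (intro disjI2 exI[of _ q] exI[of _ "m - n"]) auto
  with same show ?thesis
    using demand_le_height by fastforce
next
  case (apart i)
  have "m - n + t \<le> 3 * 8 ^ i"
    using scales_bound[OF apart(1,4) assms(4)] by linarith
  with apart have "demand s (m - n + t) (3 * i)"
    unfolding demand_def by (intro disjI1 exI[of _ q] bexI[of _ i]) auto
  then have "3 * i \<le> height s (m - n + t)"
    using demand_le_height by fastforce
  with apart scales_ge[OF apart(1)] show ?thesis
    by linarith
qed

text \<open>Serves the decay of the vector: one i bounds both position and height, so far positions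
  have large height.\<close>

lemma height_sites:
  assumes "m \<in> sites s q" "t \<le> q"
  obtains i where "q \<le> i" "3 * i \<le> height s (m + t)" "m + t \<le> 3 * 8 ^ i"
proof -
  obtain i where i: "i \<in> scales s q" "8 ^ i \<le> m" "m < 2 * 8 ^ i"
    using assms by (auto simp: sites_def)
  have "6 * 8 ^ (i - 1) \<le> (8::nat) ^ i"
    by (cases i) (use scales_ge[OF i(1)] in auto)
  with i have "demand s (m + t) (3 * i)"
    using scales_bound[OF i(1,3) assms(2)]
    unfolding demand_def by (intro disjI1 exI[of _ q] bexI[of _ i]) auto
  then have "3 * i \<le> height s (m + t)"
    using demand_le_height by fastforce
  with that[of i] show thesis
    using scales_ge[OF i(1)] scales_bound[OF i(1,3) assms(2)] by simp
qed

section \<open>A dense sequence of targets\<close>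

text \<open>Lists of pairs of rationals form a countable type, so \<open>from_nat\<close> enumerates
  these sequences.\<close>

definition rat_seq :: "(rat \<times> rat) list \<Rightarrow> nat \<Rightarrow> complex" where
  "rat_seq l t = (if t < length l then Complex (of_rat (fst (l ! t))) (of_rat (snd (l ! t))) else 0)"

lemma rat_seq_dense:
  assumes "x \<in> c0" "0 < e"
  obtains l where "\<And>t. norm (rat_seq l t - x t) \<le> e"
proof -
  have approx: "\<exists>r. \<bar>of_rat r - y\<bar> \<le> e / 2" for y :: real
  proof -
    obtain r where "y < of_rat r" "of_rat r < y + e / 2"
      using of_rat_dense[of y "y + e / 2"] \<open>0 < e\<close> by auto
    then show ?thesis
      by (intro exI[of _ r]) linarith
  qed
  define f where "f y = (SOME r. \<bar>of_rat r - y\<bar> \<le> e / 2)" for y :: real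
  have f: "\<bar>of_rat (f y) - y\<bar> \<le> e / 2" for y
    unfolding f_def by (rule someI_ex) (rule approx)
  obtain N where N: "\<And>n. n \<ge> N \<Longrightarrow> norm (x n) < e"
    using LIMSEQ_D[OF assms(1)[unfolded c0_def mem_Collect_eq] assms(2)] unfolding diff_0_right by blast
  define l where "l = map (\<lambda>t. (f (Re (x t)), f (Im (x t)))) [0..<N]"
  show thesis
  proof (rule that)
    fix t
    show "norm (rat_seq l t - x t) \<le> e"
    proof (cases "t < N")
      case True
      then have "norm (rat_seq l t - x t) \<le>
          \<bar>of_rat (f (Re (x t))) - Re (x t)\<bar> + \<bar>of_rat (f (Im (x t))) - Im (x t)\<bar>"
        using cmod_le[of "rat_seq l t - x t"] by (simp add: rat_seq_def l_def)
      also have "\<dots> \<le> e / 2 + e / 2"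
        by (intro add_mono f)
      finally show ?thesis by simp
    next
      case False
      then show ?thesis
        using N[of t] by (simp add: rat_seq_def l_def)
    qed
  qed
qed

text \<open>The second component of \<open>prod_decode q\<close> is free, so each list recurs for
  arbitrarily large q. Replacing early occurrences by 0 makes the bound 2^q and the support in
  [0, q] hold for all q.\<close>

definition target :: "nat \<Rightarrow> nat \<Rightarrow> complex" where
  "target q = (let u = rat_seq (from_nat (fst (prod_decode q)))
     in if \<forall>t. norm (u t) \<le> 2 ^ q \<and> (q < t \<longrightarrow> u t = 0) then u else (\<lambda>_. 0))"

lemma norm_target_le: "norm (target q t) \<le> 2 ^ q"
  by (simp add: target_def Let_def)

lemma target_eq_0: "q < t \<Longrightarrow> target q t = 0"
  by (simp add: target_def Let_def)

lemma target_dense: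
  assumes "x \<in> c0" "0 < e"
  obtains q where "\<And>t. norm (target q t - x t) \<le> e" "(1/2) ^ q \<le> e"
proof -
  obtain l where l: "\<And>t. norm (rat_seq l t - x t) \<le> e"
    using rat_seq_dense[OF assms] by blast
  have "bounded (range (rat_seq l))"
  proof (rule finite_imp_bounded, rule finite_subset)
    show "range (rat_seq l) \<subseteq> insert 0 (rat_seq l ` {..<length l})"
      by (auto simp: rat_seq_def)
  qed simp
  then obtain C where C: "\<And>t. norm (rat_seq l t) \<le> C"
    unfolding bounded_iff by blast
  obtain a where a: "C < 2 ^ a"
    using real_arch_pow[of 2 C] by auto
  obtain b where b: "(1/2) ^ b < e"
    using real_arch_pow_inv[of e "1/2"] \<open>0 < e\<close> by auto
  \<comment> \<open>Since q is at least the padding, it dominates \<open>a\<close> (size),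
    \<open>b\<close> (accuracy) and the length (support).\<close>
  define q where "q = prod_encode (to_nat l, a + b + length l)"
  have q: "a + b + length l \<le> q"
    unfolding q_def by (rule le_prod_encode_2)
  have "norm (rat_seq l t) \<le> 2 ^ q" for t
  proof -
    have "(2::real) ^ a \<le> 2 ^ q"
      using q by (intro power_increasing) auto
    with C[of t] a show ?thesis by linarith
  qed
  moreover have "rat_seq l t = 0" if "q < t" for t
    using q that by (simp add: rat_seq_def)
  ultimately have "target q = rat_seq l"
    unfolding target_def by (simp add: q_def)
  moreover have "(1/2::real) ^ q \<le> (1/2) ^ b"
    using q by (intro power_decreasing) auto
  with b have "(1/2::real) ^ q \<le> e"
    by linarith
  ultimately show thesis
    using that[of q] l by simp
qed

section \<open>The frequently hypercyclic vector\<close>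

text \<open>The sequence of the W_k x_k, where x is the frequently hypercyclic vector.\<close>

definition pattern :: "nat \<Rightarrow> nat \<Rightarrow> complex" where
  "pattern s k = (if \<exists>q m t. m \<in> sites s q \<and> t \<le> q \<and> k = m + t
     then let (q, t) = SOME (q, t). \<exists>m. m \<in> sites s q \<and> t \<le> q \<and> k = m + t
       in 2 ^ height s t * target q t
     else 0)"

definition fh_vector :: "nat \<Rightarrow> nat \<Rightarrow> complex" where
  "fh_vector s k = pattern s k / 2 ^ height s k"

lemma pattern_sites:
  assumes "m \<in> sites s q" "t \<le> q"
  shows "pattern s (m + t) = 2 ^ height s t * target q t"
proof -
  have "(SOME (q', t'). \<exists>m'. m' \<in> sites s q' \<and> t' \<le> q' \<and> m + t = m' + t') = (q, t)"
    by (rule some_equality) (use assms sites_unique in blast)+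
  with assms show ?thesis
    unfolding pattern_def by auto
qed

lemma pattern_nonzero:
  assumes "pattern s k \<noteq> 0"
  obtains q m t where "m \<in> sites s q" "t \<le> q" "k = m + t"
  using assms by (auto simp: pattern_def split: if_splits)

text \<open>One factor 2^q comes from W_t with t <= q, the other from the target.\<close>

lemma norm_pattern_le:
  assumes "m \<in> sites s q" "t \<le> q"
  shows "norm (pattern s (m + t)) \<le> 2 ^ (2 * q)"
proof -
  have "(2::real) ^ height s t \<le> 2 ^ q"
    using height_le[of s t] assms by (intro power_increasing) auto
  then have "2 ^ height s t * norm (target q t) \<le> 2 ^ q * 2 ^ q"
    by (intro mult_mono norm_target_le) auto
  then show ?thesis
    by (simp add: pattern_sites[OF assms] norm_mult norm_power mult_2 power_add)
qed

lemma half_power_bound: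
  assumes "y \<le> 2 ^ a" "a + q \<le> h"
  shows "y / 2 ^ h \<le> (1/2::real) ^ q"
proof -
  have "y * 2 ^ q \<le> 2 ^ a * 2 ^ q"
    using assms by simp
  also have "\<dots> \<le> 2 ^ h"
    using assms by (simp flip: power_add)
  finally show ?thesis
    by (simp add: power_divide divide_simps)
qed

lemma fh_vector_c0: "fh_vector s \<in> c0"
  unfolding c0_def mem_Collect_eq
proof (rule LIMSEQ_I)
  fix e :: real assume "0 < e"
  then obtain b where b: "(1/2) ^ b < e"
    using real_arch_pow_inv[of e "1/2"] by auto
  have "norm (fh_vector s k) < e" if k: "k > 3 * 8 ^ b" for k
  proof (cases "pattern s k = 0")
    case True
    with \<open>0 < e\<close> show ?thesis by (simp add: fh_vector_def)
  next
    case False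
    then obtain q m t where m: "m \<in> sites s q" "t \<le> q" "k = m + t"
      by (rule pattern_nonzero)
    obtain i where i: "q \<le> i" "3 * i \<le> height s k" "k \<le> 3 * 8 ^ i"
      using height_sites[OF m(1,2)] m(3) by blast
    have "(8::nat) ^ b < 8 ^ i"
      using i k by linarith
    then have "b < i"
      by simp
    \<comment> \<open>Here \<open>2 * q + b <= 3 * i\<close>, because q <= i and b < i.\<close>
    then have "norm (pattern s k) / 2 ^ height s k \<le> (1/2) ^ b"
      using norm_pattern_le[OF m(1,2)] i m(3) by (intro half_power_bound[of _ "2 * q"]) auto
    with b show ?thesis
      by (simp add: fh_vector_def norm_divide norm_power)
  qed
  then show "\<exists>no. \<forall>n\<ge>no. norm (fh_vector s n - 0) < e"
    by (intro exI[of _ "Suc (3 * 8 ^ b)"]) (simp add: Suc_le_eq)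
qed

text \<open>On [0, q] the copy is exact. Beyond q only copies at later sites m show up, at
  coordinates m - n + t, where \<open>height_sites_diff\<close> makes W large enough to shrink
  them.\<close>

lemma fh_vector_orbit:
  assumes n: "n \<in> sites s q"
  shows "norm ((bshift (weight s) ^^ n) (fh_vector s) k - target q k) \<le> (1/2) ^ q"
proof -
  have orbit: "(bshift (weight s) ^^ n) (fh_vector s) k = pattern s (n + k) / 2 ^ height s k"
    by (simp add: funpow_bshift_weight fh_vector_def)
  show ?thesis
  proof (cases "k \<le> q")
    case True
    with n show ?thesis
      by (simp add: orbit pattern_sites)
  next
    case False
    show ?thesis
    proof (cases "pattern s (n + k) = 0")
      case True
      with False show ?thesis by (simp add: orbit target_eq_0)
    next
      case nz: False
      then obtain p m t where m: "m \<in> sites s p" "t \<le> p" "n + k = m + t"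
        by (rule pattern_nonzero)
      \<comment> \<open>A site determines its index, so m = n would give p = q and k = t <=
        q.\<close>
      have "m \<noteq> n"
      proof
        assume "m = n"
        with m n sites_unique[of m s p n q 0 0] False show False by auto
      qed
      moreover have "\<not> m < n"
        using sites_gap[OF n m(1)] m by linarith
      ultimately have "n < m" by simp
      moreover have "k = m - n + t"
        using m \<open>n < m\<close> by linarith
      ultimately have "2 * p + q \<le> height s k"
        using height_sites_diff[OF m(1) n _ m(2)] by simp
      then have "norm (pattern s (n + k)) / 2 ^ height s k \<le> (1/2) ^ q"
        using norm_pattern_le[OF m(1,2)] m(3) by (intro half_power_bound[of _ "2 * p"]) auto
      with False show ?thesis
        by (simp add: orbit target_eq_0 norm_divide norm_power)
    qed
  qed
qed

lemma freq_hypercyclic_weight: "freq_hypercyclic c0 c0_open (bshift (weight s))"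
  unfolding freq_hypercyclic_def
proof (intro bexI[of _ "fh_vector s"] fh_vector_c0 allI impI)
  fix V assume V: "c0_open V \<and> V \<noteq> {}"
  then obtain v where v: "v \<in> V" "v \<in> c0"
    by (auto simp: c0_open_def)
  then obtain e where e: "0 < e" "\<And>y. y \<in> c0 \<Longrightarrow> c0_dist v y < e \<Longrightarrow> y \<in> V"
    using V unfolding c0_open_def by blast
  obtain q where q: "\<And>t. norm (target q t - v t) \<le> e / 3" "(1/2) ^ q \<le> e / 3"
    using target_dense[OF v(2), of "e / 3"] e(1) by auto
  have "sites s q \<subseteq> return_set (bshift (weight s)) (fh_vector s) V"
  proof
    fix n assume n: "n \<in> sites s q"
    define z where "z = (bshift (weight s) ^^ n) (fh_vector s)"
    have "norm (v k - z k) \<le> 2 * e / 3" for k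
      using norm_triangle_ineq[of "v k - target q k" "target q k - z k"]
        q(1)[of k] q(2) fh_vector_orbit[OF n, of k]
      unfolding z_def by (simp add: norm_minus_commute)
    then have "c0_dist v z \<le> 2 * e / 3"
      by (rule c0_dist_le)
    moreover have "z \<in> c0"
      unfolding z_def by (intro funpow_bshift_c0[of _ 2] norm_weight_le fh_vector_c0)
    ultimately have "z \<in> V"
      using e by simp
    then show "n \<in> return_set (bshift (weight s)) (fh_vector s) V"
      by (simp add: return_set_def z_def)
  qed
  then show "0 < lower_density (return_set (bshift (weight s)) (fh_vector s) V)"
    using lower_density_sites[of s q] lower_density_mono less_le_trans by blast
qed

section \<open>Failure for the direct sum\<close>

lemma funpow_pair:
  fixes f :: "'a \<Rightarrow> 'a" and g :: "'b \<Rightarrow> 'b"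
  shows "((\<lambda>p. (f (fst p), g (snd p))) ^^ n) p = ((f ^^ n) (fst p), (g ^^ n) (snd p))"
  by (induction n) auto

lemma eventually_height_gt:
  assumes x: "x \<in> c0"
  shows "\<forall>\<^sub>F n in sequentially.
    norm ((bshift (weight s) ^^ n) x 0 - 1) < 1/2 \<longrightarrow> C < height s n"
proof -
  \<comment> \<open>With this threshold, W_n |x_n| > 1/2 forces W_n > 2^C.\<close>
  have "\<forall>\<^sub>F n in sequentially. norm (x n) < 1 / (2 * 2 ^ C)"
    using x tendstoD[of x 0 sequentially "1 / (2 * 2 ^ C)"] by (simp add: c0_def)
  then show ?thesis
  proof eventually_elim
    fix n assume n: "norm (x n) < 1 / (2 * 2 ^ C)"
    show "norm ((bshift (weight s) ^^ n) x 0 - 1) < 1/2 \<longrightarrow> C < height s n"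
    proof
      assume *: "norm ((bshift (weight s) ^^ n) x 0 - 1) < 1/2"
      have "height s 0 = 0"
        using height_le[of s 0] by simp
      then have "norm ((bshift (weight s) ^^ n) x 0) = 2 ^ height s n * norm (x n)"
        by (simp add: funpow_bshift_weight norm_mult norm_power)
      moreover have "1 \<le> norm ((bshift (weight s) ^^ n) x 0) + norm ((bshift (weight s) ^^ n) x 0 - 1)"
        using norm_triangle_ineq4[of "(bshift (weight s) ^^ n) x 0" "(bshift (weight s) ^^ n) x 0 - 1"]
        by simp
      ultimately have "1/2 < 2 ^ height s n * norm (x n)"
        using * by linarith
      also have "\<dots> \<le> 2 ^ height s n * (1 / (2 * 2 ^ C))"
        using n by (intro mult_left_mono) auto
      finally have "(2::real) ^ C < 2 ^ height s n"
        by (simp add: field_simps)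
      then show "C < height s n"
        by simp
    qed
  qed
qed

lemma c0_sum_open_near_1:
  "c0_sum_open {p \<in> c0 \<times> c0. norm (fst p 0 - 1) < 1/2 \<and> norm (snd p 0 - 1) < 1/2}"
  (is "c0_sum_open ?V")
  unfolding c0_sum_open_def
proof (intro conjI ballI)
  fix p assume p: "p \<in> ?V"
  define e where "e = min (1/2 - norm (fst p 0 - 1)) (1/2 - norm (snd p 0 - 1))"
  show "\<exists>e>0. \<forall>q\<in>c0 \<times> c0. max (c0_dist (fst p) (fst q)) (c0_dist (snd p) (snd q)) < e \<longrightarrow> q \<in> ?V"
  proof (intro exI[of _ e] conjI ballI impI)
    show "0 < e"
      using p by (simp add: e_def)
    fix q assume q: "q \<in> c0 \<times> c0"
      and d: "max (c0_dist (fst p) (fst q)) (c0_dist (snd p) (snd q)) < e"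
    have "norm (y 0 - 1) < 1/2"
      if "x \<in> c0" "y \<in> c0" "c0_dist x y < e" "e \<le> 1/2 - norm (x 0 - 1)" for x y :: "nat \<Rightarrow> complex"
      using c0_dist_upper[OF that(1,2), of 0] norm_triangle_ineq[of "y 0 - x 0" "x 0 - 1"] that(3,4)
      by (simp add: norm_minus_commute)
    then show "q \<in> ?V"
      using p q d by (auto simp: mem_Times_iff e_def)
  qed
qed auto

theorem theorem4p2:
  shows "\<exists>w w'. bounded_weight w \<and> bounded_weight w' \<and>
     freq_hypercyclic c0 c0_open (bshift w) \<and>
     freq_hypercyclic c0 c0_open (bshift w') \<and>
     \<not> U_freq_hypercyclic (c0 \<times> c0) c0_sum_open
          (\<lambda>p. (bshift w (fst p), bshift w' (snd p)))"
proof -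
  \<comment> \<open>The parameters 0 and 1 place the windows of the two weights at even and at odd
    scales.\<close>
  define T where "T = (\<lambda>p. (bshift (weight 0) (fst p), bshift (weight 1) (snd p)))"
  define V where "V = {p \<in> c0 \<times> c0. cmod (fst p 0 - 1) < 1/2 \<and> cmod (snd p 0 - 1) < 1/2}"
  define u :: "nat \<Rightarrow> complex" where "u = (\<lambda>n. if n = 0 then 1 else 0)"
  have "\<forall>\<^sub>F n in sequentially. u n = 0"
    using eventually_gt_at_top[of 0] by eventually_elim (simp add: u_def)
  then have "u \<in> c0"
    by (simp add: c0_def tendsto_eventually)
  then have "(u, u) \<in> V"
    by (simp add: V_def u_def)
  then have "V \<noteq> {}" by blast
  \<comment> \<open>A single open set defeats every x: beyond some M, returns to \<open>V\<close>
    lie in collars with q >= Q, of upper density at most 2^(-Q), for each Q.\<close>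
  have "upper_density (return_set T x V) \<le> 0" if x: "x \<in> c0 \<times> c0" for x
  proof (rule ereal_le_epsilon2)
    have x1: "fst x \<in> c0" and x2: "snd x \<in> c0"
      using x by (simp_all add: mem_Times_iff)
    fix e :: real assume "0 < e"
    then obtain Q where Q: "(1/2) ^ Q < e"
      using real_arch_pow_inv[of e "1/2"] by auto
    have "\<forall>\<^sub>F n in sequentially. n \<in> return_set T x V \<longrightarrow> n \<in> (\<Union>q\<in>{Q..}. collars q)"
      using eventually_height_gt[OF x1, of 0 "3 * Q"] eventually_height_gt[OF x2, of 1 "3 * Q"]
    proof eventually_elim
      case (elim n)
      show ?case
      proof
        assume "n \<in> return_set T x V"
        then have "3 * Q < height 0 n" "3 * Q < height 1 n"
          using elim by (simp_all add: return_set_def T_def V_def funpow_pair)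
        then show "n \<in> (\<Union>q\<in>{Q..}. collars q)"
          using heights_collars by auto
      qed
    qed
    then obtain M where M: "\<And>n. n \<ge> M \<Longrightarrow> n \<in> return_set T x V \<Longrightarrow> n \<in> (\<Union>q\<in>{Q..}. collars q)"
      by (auto simp: eventually_sequentially)
    have "upper_density (return_set T x V) \<le> ereal ((1/2) ^ Q)"
    proof (rule upper_density_le)
      fix N :: nat
      have "card (return_set T x V \<inter> {1..N}) \<le> card ((\<Union>q\<in>{Q..}. collars q) \<inter> {1..N} \<union> {..<M})"
        using M by (intro card_mono) (auto simp: not_less)
      also have "\<dots> \<le> card ((\<Union>q\<in>{Q..}. collars q) \<inter> {1..N}) + M"
        using card_Un_le[of _ "{..<M}"] by simp
      finally show "real (card (return_set T x V \<inter> {1..N})) \<le> (1/2) ^ Q * real N + real M"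
        using card_UN_collars_le[of Q N] by linarith
    qed
    also have "ereal ((1/2) ^ Q) \<le> 0 + ereal e"
      using Q by simp
    finally show "upper_density (return_set T x V) \<le> 0 + ereal e" .
  qed
  then have "\<not> U_freq_hypercyclic (c0 \<times> c0) c0_sum_open T"
    unfolding U_freq_hypercyclic_def
    using c0_sum_open_near_1[folded V_def] \<open>V \<noteq> {}\<close> by (meson not_le)
  then show ?thesis
    unfolding T_def using bounded_weight_weight freq_hypercyclic_weight
    by (intro exI[of _ "weight 0"] exI[of _ "weight 1"]) auto
qed

end
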